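(* Let $n,N\ge 1$ and let $\mathbf{X}=(X_{ij})$ be an $n\times N$ complex random matrix whose entries $X_{ij}$ ($1\le i\le n$, $1\le j\le N$) are independent and bounded by $1$, i.e. $|X_{ij}|\le 1$. Let $\lambda_1\ge\lambda_2\ge\cdots\ge\lambda_n$ be the $n$ (nonnegative) eigenvalues, counted with multiplicity, of $\frac1N\mathbf{X}\mathbf{X}^*$. Then for all $1\le k\le n$ and all $t\ge 0$, $$P(\lambda_k-E\lambda_k\ge t)\le\exp\left(-\frac{Nt^2}{2n^2}\right)\quad\text{and}\quad P(\lambda_k-E\lambda_k\le -t)\le\exp\left(-\frac{Nt^2}{2n^2}\right).$$
   Context: $\mathbf{X}^*$ denotes the conjugate transpose of $\mathbf{X}$. The entries are complex-valued random variables, not assumed to be identically distributed or centered. *)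

theory Defs
  imports
    "HOL-Probability.Probability"
    "Jordan_Normal_Form.Schur_Decomposition"
begin

definition sample_cov :: "complex mat \<Rightarrow> complex mat" where
  "sample_cov X = (1 / of_nat (dim_col X)) \<cdot>\<^sub>m (X * mat_adjoint X)"

(* Real parts of the complex eigenvalues, counted with algebraic multiplicity, in decreasing
   order. This is only meant for matrices all of whose eigenvalues are real; for
   sample_cov X this is sample_cov_proots below. *)
definition eigvals_desc :: "complex mat \<Rightarrow> real list" where
  "eigvals_desc A = rev (sorted_list_of_multiset (image_mset Re (proots (char_poly A))))"

(* k starts at 1: kth_eigval 1 A is the largest eigenvalue *)
definition kth_eigval :: "nat \<Rightarrow> complex mat \<Rightarrow> real" where
  "kth_eigval k A = eigvals_desc A ! (k - 1)"

lemma sample_cov_carrier: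
  assumes "X \<in> carrier_mat n N"
  shows "sample_cov X \<in> carrier_mat n n"
  using assms by (auto simp: sample_cov_def mat_adjoint_def)

lemma sample_cov_index:
  assumes X: "X \<in> carrier_mat n N" and "i < n" "j < n"
  shows "sample_cov X $$ (i, j) = (1 / of_nat N) * (\<Sum>l<N. X $$ (i, l) * cnj (X $$ (j, l)))"
  using assms
  by (auto simp: sample_cov_def mat_adjoint_def scalar_prod_def mat_of_rows_def
        atLeast0LessThan intro!: sum.cong)

lemma sample_cov_eigenvalue:
  assumes X: "X \<in> carrier_mat n N" and ev: "eigenvalue (sample_cov X) z"
  shows "Im z = 0" "Re z \<ge> 0"
proof -
  let ?G = "sample_cov X"
  have G: "?G \<in> carrier_mat n n" by (rule sample_cov_carrier[OF X])
  obtain v where v: "v \<in> carrier_vec n" "v \<noteq> 0\<^sub>v n" "?G *\<^sub>v v = z \<cdot>\<^sub>v v"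
    using ev G unfolding eigenvalue_def eigenvector_def by auto
  define y where "y = (\<lambda>l. \<Sum>j<n. cnj (X $$ (j, l)) * v $ j)"
  define s where "s = (\<Sum>i<n. (cmod (v $ i))\<^sup>2)"
  define r where "r = (\<Sum>l<N. (cmod (y l))\<^sup>2) / real N"
  have row: "z * v $ i = (\<Sum>l<N. X $$ (i, l) * y l) / of_nat N" if i: "i < n" for i
  proof -
    have "z * v $ i = (?G *\<^sub>v v) $ i" using v i by simp
    also have "\<dots> = (\<Sum>j<n. ?G $$ (i, j) * v $ j)"
      using v(1) G i by (auto simp: scalar_prod_def atLeast0LessThan)
    also have "\<dots> = (\<Sum>j<n. (\<Sum>l<N. X $$ (i, l) * (cnj (X $$ (j, l)) * v $ j)) / of_nat N)"
      by (rule sum.cong)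
        (auto simp: sample_cov_index[OF X i] sum_distrib_right sum_divide_distrib mult.assoc)
    also have "\<dots> = (\<Sum>l<N. X $$ (i, l) * y l) / of_nat N"
      unfolding y_def sum_distrib_left sum_divide_distrib[symmetric]
      by (subst sum.swap) simp
    finally show ?thesis .
  qed
  have "z * complex_of_real s = (\<Sum>i<n. cnj (v $ i) * (z * v $ i))"
    unfolding s_def of_real_sum sum_distrib_left
    by (rule sum.cong) (auto simp: complex_norm_square mult_ac simp flip: of_real_power)
  also have "\<dots> = (\<Sum>i<n. (\<Sum>l<N. cnj (v $ i) * X $$ (i, l) * y l) / of_nat N)"
    by (rule sum.cong) (auto simp: row sum_distrib_left mult.assoc)
  also have "\<dots> = (\<Sum>l<N. cnj (y l) * y l) / of_nat N"
    unfolding sum_divide_distrib[symmetric] y_def cnj_sum sum_distrib_right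
    by (subst sum.swap) (auto simp: mult_ac)
  also have "\<dots> = complex_of_real r"
    unfolding r_def by (simp add: complex_norm_square mult.commute flip: of_real_power)
  finally have eq: "z * complex_of_real s = complex_of_real r" .
  obtain i where "i < n" "v $ i \<noteq> 0" using v by (metis carrier_vecD eq_vecI index_zero_vec)
  then have s: "s > 0" unfolding s_def by (intro sum_pos2[of _ i]) auto
  have r: "r \<ge> 0" unfolding r_def by (simp add: sum_nonneg)
  have "z = complex_of_real (r / s)" using eq s by (simp add: field_simps)
  then show "Im z = 0" "Re z \<ge> 0" using r s by auto
qed

lemma sample_cov_proots:
  assumes X: "X \<in> carrier_mat n N"
  shows "image_mset complex_of_real (mset (eigvals_desc (sample_cov X)))
           = proots (char_poly (sample_cov X))"
    and "length (eigvals_desc (sample_cov X)) = n"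
    and "\<forall>x\<in>set (eigvals_desc (sample_cov X)). x \<ge> 0"
proof -
  let ?p = "char_poly (sample_cov X)"
  note G = sample_cov_carrier[OF X]
  have p: "degree ?p = n" "?p \<noteq> 0"
    using degree_monic_char_poly[OF G] by auto
  have root: "Im z = 0 \<and> Re z \<ge> 0" if "z \<in># proots ?p" for z
    using that p sample_cov_eigenvalue[OF X] eigenvalue_root_char_poly[OF G] by auto
  have "image_mset (\<lambda>z. complex_of_real (Re z)) (proots ?p) = image_mset (\<lambda>z. z) (proots ?p)"
    by (rule image_mset_cong) (use root in \<open>auto simp: complex_eq_iff\<close>)
  then show "image_mset complex_of_real (mset (eigvals_desc (sample_cov X))) = proots ?p"
    by (simp add: eigvals_desc_def multiset.map_comp comp_def)
  show "length (eigvals_desc (sample_cov X)) = n"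
    using p size_proots_complex[of ?p] by (simp add: eigvals_desc_def flip: size_mset)
  show "\<forall>x\<in>set (eigvals_desc (sample_cov X)). x \<ge> 0"
    using root by (auto simp: eigvals_desc_def)
qed

end

(* Replacing one column of X changes X X* by the difference of two positive semidefinite rank-one
   matrices with norm at most n, so by Weyl's inequality every eigenvalue of X X* / N moves by at
   most n / N. The columns are independent, and a bounded differences inequality, proved by
   integrating out one column at a time with Hoeffding's lemma, gives the two tail bounds.

   Weyl's inequality comes from intersecting the span of the top k eigenvectors of one matrix with
   the span of the bottom n - k + 1 eigenvectors of the other. The eigenbases come from the Jordan
   normal form: for Hermitian A the kernels of A - e and (A - e)^2 agree, so all blocks have size 1.
   Weyl's inequality also makes the eigenvalues continuous, hence measurable, in the entries. *)

theory Submission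
  imports
    Defs
    "HOL-Combinatorics.Permutations"
    "Jordan_Normal_Form.Jordan_Normal_Form_Existence"
    "Jordan_Normal_Form.Jordan_Normal_Form_Uniqueness"
begin

unbundle no vec_syntax

section \<open>Hermitian matrices\<close>

lemma mat_adjoint_index:
  assumes "i < dim_col A" "j < dim_row A"
  shows "mat_adjoint A $$ (i, j) = conjugate (A $$ (j, i))"
  using assms by (simp add: mat_adjoint_def mat_of_rows_def)

lemma hermitian_index:
  assumes "A \<in> carrier_mat n n" "mat_adjoint A = A" "i < n" "j < n"
  shows "conjugate (A $$ (j, i)) = A $$ (i, j)"
  using mat_adjoint_index[of i A j] assms by simp

lemma cscalar_prod_sum:
  assumes "w \<in> carrier_vec n"
  shows "v \<bullet>c w = (\<Sum>i<n. v $ i * conjugate (w $ i))"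
  using assms by (auto simp: scalar_prod_def atLeast0LessThan)

lemma hermitian_cscalar_prod:
  fixes A :: "complex mat"
  assumes A: "A \<in> carrier_mat n n" "mat_adjoint A = A"
    and v: "v \<in> carrier_vec n" and w: "w \<in> carrier_vec n"
  shows "(A *\<^sub>v v) \<bullet>c w = v \<bullet>c (A *\<^sub>v w)"
proof -
  have "(A *\<^sub>v v) \<bullet>c w = (\<Sum>i<n. \<Sum>j<n. A $$ (i, j) * v $ j * cnj (w $ i))"
    using A v w
    by (subst cscalar_prod_sum[OF w])
      (auto simp: scalar_prod_def sum_distrib_right atLeast0LessThan intro!: sum.cong)
  also have "\<dots> = (\<Sum>j<n. \<Sum>i<n. v $ j * cnj (A $$ (j, i) * w $ i))"
    using hermitian_index[OF A] by (subst sum.swap) (auto intro!: sum.cong)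
  also have "\<dots> = v \<bullet>c (A *\<^sub>v w)"
    using A v w
    by (subst cscalar_prod_sum[of _ n])
      (auto simp: scalar_prod_def sum_distrib_left atLeast0LessThan intro!: sum.cong)
  finally show ?thesis .
qed

lemma hermitian_eigenvalue_real:
  fixes A :: "complex mat"
  assumes A: "A \<in> carrier_mat n n" "mat_adjoint A = A" and z: "eigenvalue A z"
  shows "cnj z = z"
proof -
  obtain v where v: "v \<in> carrier_vec n" "v \<noteq> 0\<^sub>v n" "A *\<^sub>v v = z \<cdot>\<^sub>v v"
    using z A unfolding eigenvalue_def eigenvector_def by auto
  have "z * (v \<bullet>c v) = cnj z * (v \<bullet>c v)"
    using hermitian_cscalar_prod[OF A v(1) v(1)] v by (simp add: conjugate_smult_vec)
  moreover have "v \<bullet>c v \<noteq> 0" using v conjugate_square_eq_0_vec by auto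
  ultimately show ?thesis by (metis mult_right_cancel)
qed

section \<open>Diagonalisability of Hermitian matrices\<close>

lemma char_matrix_mult_vec:
  fixes A :: "'a :: field mat"
  assumes "A \<in> carrier_mat n n" "v \<in> carrier_vec n"
  shows "char_matrix A e *\<^sub>v v = A *\<^sub>v v - e \<cdot>\<^sub>v v"
proof -
  have "char_matrix A e *\<^sub>v v = A *\<^sub>v v + (- e \<cdot>\<^sub>m 1\<^sub>m n) *\<^sub>v v"
    using assms unfolding char_matrix_def by (subst add_mult_distrib_mat_vec[of _ n n]) auto
  also have "(- e \<cdot>\<^sub>m 1\<^sub>m n) *\<^sub>v v = - e \<cdot>\<^sub>v v"
    using assms(2) by (intro eq_vecI) (auto simp: row_smult)
  finally show ?thesis using assms by (intro eq_vecI) auto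
qed

text \<open>If (A - e)^2 v = 0, then w = (A - e) v lies in both the kernel and the range of A - e. A
  nonzero w would be an eigenvector, which makes e real and A - e self-adjoint; kernel and range are
  then orthogonal, so w would be orthogonal to itself.\<close>

lemma hermitian_mat_kernel_square:
  fixes A :: "complex mat"
  assumes A: "A \<in> carrier_mat n n" "mat_adjoint A = A"
  shows "mat_kernel (char_matrix A e ^\<^sub>m 2) = mat_kernel (char_matrix A e)"
proof -
  let ?C = "char_matrix A e"
  have C: "?C \<in> carrier_mat n n" using A by simp
  have C2: "?C ^\<^sub>m 2 = ?C * ?C" using C by (simp add: numeral_2_eq_2)
  have "?C *\<^sub>v v = 0\<^sub>v n" if v: "v \<in> carrier_vec n" and "(?C * ?C) *\<^sub>v v = 0\<^sub>v n" for v
  proof (rule ccontr)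
    assume nz: "?C *\<^sub>v v \<noteq> 0\<^sub>v n"
    define w where "w = ?C *\<^sub>v v"
    have w: "w \<in> carrier_vec n" "w \<noteq> 0\<^sub>v n" using C v nz unfolding w_def by auto
    have w0: "?C *\<^sub>v w = 0\<^sub>v n" using that C by (simp add: w_def assoc_mult_mat_vec[of _ n n _ n])
    then have "eigenvector A w e" using eigenvector_char_matrix[OF A(1)] w by simp
    then have Aw: "A *\<^sub>v w = e \<cdot>\<^sub>v w" and e: "cnj e = e"
      using hermitian_eigenvalue_real[OF A] by (auto simp: eigenvector_def eigenvalue_def)
    have "w \<bullet>c w = (A *\<^sub>v v - e \<cdot>\<^sub>v v) \<bullet>c w"
      using char_matrix_mult_vec[OF A(1) v] by (simp add: w_def)
    also have "\<dots> = (A *\<^sub>v v) \<bullet>c w - e * (v \<bullet>c w)"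
      using A v w by (subst minus_scalar_prod_distrib[of _ n]) auto
    also have "\<dots> = 0"
      using hermitian_cscalar_prod[OF A v w(1)] v w e Aw by (simp add: conjugate_smult_vec)
    finally show False using w conjugate_square_eq_0_vec by auto
  qed
  then show ?thesis unfolding C2 using C by (auto simp: mat_kernel_def assoc_mult_mat_vec[of _ n n _ n])
qed

text \<open>The kernel of (A - a)^j has dimension the sum of \<open>min j m\<close> over the sizes m
  of the blocks with eigenvalue a. Since the kernels for j = 1 and j = 2 agree, no such block can be
  larger than 1.\<close>

lemma hermitian_jordan_blocks:
  fixes A :: "complex mat"
  assumes A: "A \<in> carrier_mat n n" "mat_adjoint A = A" and jnf: "jordan_nf A n_as"
    and mem: "(m, a) \<in> set n_as"
  shows "m = 1"
proof -
  let ?C = "char_matrix A a" and ?L = "map fst (filter (\<lambda>(n, e). e = a) n_as)"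
  have C: "?C \<in> carrier_mat n n" using A by simp
  have C1: "?C ^\<^sub>m 1 = ?C" using C by simp
  have "dim_gen_eigenspace A a 1 = dim_gen_eigenspace A a 2"
    unfolding dim_gen_eigenspace_def kernel_dim_def C1 hermitian_mat_kernel_square[OF A]
      carrier_matD(2)[OF C] carrier_matD(2)[OF pow_carrier_mat[OF C]] ..
  then have eq: "(\<Sum>n\<leftarrow>?L. min 1 n) = (\<Sum>n\<leftarrow>?L. min 2 n)"
    unfolding dim_gen_eigenspace[OF jnf] .
  \<comment> \<open>Each term on the left is at most the corresponding term on the right, so equal
    sums force equal terms.\<close>
  have min_eq: "\<forall>x\<in>set L. min 1 x = min 2 x"
    if "(\<Sum>n\<leftarrow>L. min 1 n) = (\<Sum>n\<leftarrow>L. min 2 n)" for L :: "nat list"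
    using that
  proof (induction L)
    case (Cons y L)
    have "(\<Sum>n\<leftarrow>L. min 1 n) \<le> (\<Sum>n\<leftarrow>L. min 2 n)" by (rule sum_list_mono) auto
    then have "min 1 y = min 2 y \<and> (\<Sum>n\<leftarrow>L. min 1 n) = (\<Sum>n\<leftarrow>L. min 2 n)"
      using Cons.prems by (simp only: list.map sum_list.Cons) linarith
    then show ?case using Cons.IH by simp
  qed simp
  have "m \<in> set ?L" using mem by (auto simp: image_iff intro!: bexI[of _ "(m, a)"])
  then have "min 1 m = min 2 m" using min_eq[OF eq] by blast
  \<comment> \<open>\<open>jordan_nf\<close> excludes empty blocks, which would also satisfy the
    equation for the minima.\<close>
  moreover have "m \<noteq> 0" using jnf mem by (auto simp: jordan_nf_def image_iff)
  ultimately show ?thesis by linarith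
qed

lemma jordan_matrix_all_blocks_1:
  "jordan_matrix (map (Pair 1) ds) = mat (length ds) (length ds) (\<lambda>(i, j). if i = j then ds ! i else 0)"
proof (induction ds)
  case Nil
  show ?case by (intro eq_matI) (auto simp: jordan_matrix_def)
next
  case (Cons d ds)
  have [simp]: "sum_list (map (fst \<circ> Pair (Suc 0)) ds) = length ds"
    by (induction ds) auto
  show ?case
    using Cons.IH
    by (intro eq_matI)
      (auto simp: jordan_matrix_Cons four_block_mat_def jordan_block_def Let_def nth_Cons')
qed

text \<open>The Jordan basis is a basis of eigenvectors; permuting it makes column \<open>i\<close>
  belong to entry \<open>i\<close> of the decreasing eigenvalue list. \<open>P\<close> is invertible
  but not claimed to be unitary.\<close>

lemma hermitian_spectral:
  fixes A :: "complex mat"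
  assumes A: "A \<in> carrier_mat n n" "mat_adjoint A = A"
  obtains P Q where "P \<in> carrier_mat n n" "Q \<in> carrier_mat n n" "P * Q = 1\<^sub>m n" "Q * P = 1\<^sub>m n"
    "\<And>i. i < n \<Longrightarrow> A *\<^sub>v col P i = complex_of_real (eigvals_desc A ! i) \<cdot>\<^sub>v col P i"
    "length (eigvals_desc A) = n"
proof -
  obtain as where "char_poly A = (\<Prod>a\<leftarrow>as. [:- a, 1:])"
    using char_poly_factorized[OF A(1)] by auto
  then obtain n_as where jnf: "jordan_nf A n_as" using jordan_nf_exists[OF A(1)] by blast
  define ds where "ds = map snd n_as"
  have n_as: "n_as = map (Pair 1) ds"
    using hermitian_jordan_blocks[OF A jnf] unfolding ds_def
    by (intro nth_equalityI) (auto simp: prod_eq_iff, metis nth_mem prod.collapse)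
  define J where "J = jordan_matrix n_as"
  have J: "J = mat (length ds) (length ds) (\<lambda>(i, j). if i = j then ds ! i else 0)"
    unfolding J_def n_as by (rule jordan_matrix_all_blocks_1)
  obtain P Q where wit: "similar_mat_wit A J P Q"
    using jnf unfolding jordan_nf_def similar_mat_def J_def by blast
  note w = similar_mat_witD2[OF A(1) wit]
  have len: "length ds = n" using w(5) J by auto
  have cp: "char_poly A = (\<Prod>d\<leftarrow>ds. [:- d, 1:])"
    using jordan_nf_char_poly[OF jnf] unfolding n_as by (simp add: comp_def)
  \<comment> \<open>Nonvanishing is carried through the induction because the roots of a product are
    the union of the roots only for nonzero factors.\<close>
  have "(\<Prod>d\<leftarrow>ds. [:- d, 1:]) \<noteq> 0 \<and> proots (\<Prod>d\<leftarrow>ds. [:- d, 1:]) = mset ds" for ds :: "complex list"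
    by (induction ds) (auto simp: proots_mult simp del: mult_pCons_left)
  then have proots: "proots (char_poly A) = mset ds" unfolding cp by blast
  have real: "complex_of_real (Re d) = d" if "d \<in> set ds" for d
  proof -
    have "poly (char_poly A) d = 0" using that unfolding cp by (auto simp: poly_prod_list)
    then show ?thesis
      using hermitian_eigenvalue_real[OF A] eigenvalue_root_char_poly[OF A(1)]
      by (metis Reals_cnj_iff of_real_Re)
  qed
  define es where "es = eigvals_desc A"
  have "mset es = mset (map Re ds)"
    by (simp add: es_def eigvals_desc_def proots)
  \<comment> \<open>\<open>p\<close> sorts the diagonal of the Jordan form. Applying it to the
    columns of \<open>P\<close> and the rows of \<open>Q\<close> alike keeps them inverse to each
    other.\<close>
  then obtain p where p: "p permutes {..<length (map Re ds)}" "permute_list p (map Re ds) = es"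
    by (rule mset_eq_permutation)
  have pn: "p i < n" if "i < n" for i using permutes_in_image[OF p(1), of i] that len by simp
  have es: "complex_of_real (es ! i) = ds ! p i" if "i < n" for i
    using real[of "ds ! p i"] pn[OF that] permute_list_nth[OF p(1)] that p(2) len by auto
  define P' where "P' = mat n n (\<lambda>(r, i). P $$ (r, p i))"
  define Q' where "Q' = mat n n (\<lambda>(i, r). Q $$ (p i, r))"
  have P': "P' \<in> carrier_mat n n" and Q': "Q' \<in> carrier_mat n n" by (auto simp: P'_def Q'_def)
  have col: "col P' i = col P (p i)" if "i < n" for i
    using that pn[OF that] w by (intro eq_vecI) (auto simp: P'_def)
  have row: "row Q' i = row Q (p i)" if "i < n" for i
    using that pn[OF that] w by (intro eq_vecI) (auto simp: Q'_def)
  have QP': "Q' * P' = 1\<^sub>m n"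
  proof (intro eq_matI)
    fix i j assume ij: "i < dim_row (1\<^sub>m n)" "j < dim_col (1\<^sub>m n)"
    have "(Q' * P') $$ (i, j) = row Q (p i) \<bullet> col P (p j)"
      using ij P' Q' by (simp add: row col)
    also have "\<dots> = (Q * P) $$ (p i, p j)"
      using w(6,7) pn ij by simp
    also have "\<dots> = 1\<^sub>m n $$ (i, j)"
      using w(2) pn ij permutes_inj[OF p(1)] by (auto dest: injD)
    finally show "(Q' * P') $$ (i, j) = 1\<^sub>m n $$ (i, j)" .
  qed (use P' Q' in auto)
  have PQ': "P' * Q' = 1\<^sub>m n" by (rule mat_mult_left_right_inverse[OF Q' P' QP'])
  have eig: "A *\<^sub>v col P' i = complex_of_real (es ! i) \<cdot>\<^sub>v col P' i" if i: "i < n" for i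
  proof -
    have "A * P = P * J * (Q * P)"
      using w by (simp add: assoc_mult_mat[of _ n n _ n _ n])
    then have AP: "A * P = P * J" using w by simp
    have "A *\<^sub>v col P' i = col (A * P) (p i)"
      using w pn i by (subst col_mult2[of _ n n]) (auto simp: col)
    also have "\<dots> = P *\<^sub>v col J (p i)"
      unfolding AP using w pn i by (subst col_mult2[of _ n n]) auto
    also have "col J (p i) = ds ! p i \<cdot>\<^sub>v unit_vec n (p i)"
      using pn[OF i] len by (intro eq_vecI) (auto simp: J)
    also have "P *\<^sub>v (ds ! p i \<cdot>\<^sub>v unit_vec n (p i)) = ds ! p i \<cdot>\<^sub>v col P (p i)"
      using w pn[OF i] by (intro eq_vecI) (auto simp: mult_mat_vec[of _ n n] scalar_prod_right_unit[of _ n])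
    finally show ?thesis using es[OF i] col[OF i] by simp
  qed
  show ?thesis
    using that[OF P' Q' PQ' QP'] eig p(2) len unfolding es_def by (metis length_map length_permute_list)
qed

section \<open>Weyl's inequality\<close>

text \<open>Writing the product through the Gram matrix of the columns lets orthogonality of
  eigenvectors be used term by term.\<close>

lemma mult_mat_vec_cscalar_prod:
  fixes P :: "complex mat"
  assumes P: "P \<in> carrier_mat m n" and x: "x \<in> carrier_vec n" and y: "y \<in> carrier_vec n"
  shows "(P *\<^sub>v x) \<bullet>c (P *\<^sub>v y) = (\<Sum>i<n. \<Sum>j<n. x $ i * cnj (y $ j) * (col P i \<bullet>c col P j))"
proof -
  have "(P *\<^sub>v x) \<bullet>c (P *\<^sub>v y)
      = (\<Sum>r<m. (\<Sum>i<n. P $$ (r, i) * x $ i) * cnj (\<Sum>j<n. P $$ (r, j) * y $ j))"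
    using P x y by (subst cscalar_prod_sum[of _ m]) (auto simp: scalar_prod_def atLeast0LessThan)
  also have "\<dots> = (\<Sum>r<m. \<Sum>i<n. \<Sum>j<n. x $ i * cnj (y $ j) * (P $$ (r, i) * cnj (P $$ (r, j))))"
    by (simp add: sum_product mult_ac)
  also have "\<dots> = (\<Sum>i<n. \<Sum>j<n. \<Sum>r<m. x $ i * cnj (y $ j) * (P $$ (r, i) * cnj (P $$ (r, j))))"
    by (subst sum.swap) (intro sum.cong refl sum.swap)
  also have "\<dots> = (\<Sum>i<n. \<Sum>j<n. x $ i * cnj (y $ j) * (col P i \<bullet>c col P j))"
    using P by (intro sum.cong refl)
      (subst cscalar_prod_sum[of _ m], auto simp: sum_distrib_left)
  finally show ?thesis .
qed

lemma hermitian_eigenvectors_orthogonal: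
  fixes A :: "complex mat"
  assumes A: "A \<in> carrier_mat n n" "mat_adjoint A = A"
    and v: "v \<in> carrier_vec n" "A *\<^sub>v v = complex_of_real x \<cdot>\<^sub>v v"
    and w: "w \<in> carrier_vec n" "A *\<^sub>v w = complex_of_real y \<cdot>\<^sub>v w"
    and "x \<noteq> y"
  shows "v \<bullet>c w = 0"
proof -
  have "complex_of_real x * (v \<bullet>c w) = complex_of_real y * (v \<bullet>c w)"
    using hermitian_cscalar_prod[OF A v(1) w(1)] v w by (simp add: conjugate_smult_vec)
  then show ?thesis using \<open>x \<noteq> y\<close> by (metis mult_right_cancel of_real_eq_iff)
qed

lemma Re_cscalar_prod_self:
  fixes v :: "complex vec"
  assumes "v \<in> carrier_vec n"
  shows "Re (v \<bullet>c v) = (\<Sum>i<n. (cmod (v $ i))\<^sup>2)"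
  unfolding cscalar_prod_sum[OF assms] Re_sum
  by (intro sum.cong refl) (simp add: cmod_power2 flip: power2_eq_square)

text \<open>The eigenvectors are not assumed to be orthogonal within an eigenspace. Taking square roots
  of the weights \<open>g (l i)\<close> on both sides of the Gram matrix, which is block diagonal
  along the eigenvalues, avoids having to orthogonalise them.\<close>

lemma hermitian_weighted_form_nonneg:
  fixes A :: "complex mat" and g :: "real \<Rightarrow> real"
  assumes A: "A \<in> carrier_mat n n" "mat_adjoint A = A" and P: "P \<in> carrier_mat n n"
    and eig: "\<And>i. i < n \<Longrightarrow> A *\<^sub>v col P i = complex_of_real (l i) \<cdot>\<^sub>v col P i"
    and a: "a \<in> carrier_vec n" and g: "\<And>i. i < n \<Longrightarrow> a $ i \<noteq> 0 \<Longrightarrow> g (l i) \<ge> 0"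
  shows "0 \<le> Re ((P *\<^sub>v vec n (\<lambda>i. complex_of_real (g (l i)) * a $ i)) \<bullet>c (P *\<^sub>v a))"
proof -
  define b where "b = vec n (\<lambda>i. complex_of_real (sqrt (g (l i))) * a $ i)"
  have b: "b \<in> carrier_vec n" by (simp add: b_def)
  have weight: "complex_of_real (g (l i)) * a $ i * cnj (a $ j) * (col P i \<bullet>c col P j)
      = b $ i * cnj (b $ j) * (col P i \<bullet>c col P j)" if ij: "i < n" "j < n" for i j
  \<comment> \<open>Within an eigenspace both square roots are the same number and multiply to the
    weight. In the other case the coordinate is zero or the two eigenvectors are orthogonal, and
    both sides vanish.\<close>
  proof (cases "l i = l j \<and> a $ i \<noteq> 0")
    case True
    then have "complex_of_real (g (l j)) = complex_of_real (sqrt (g (l j))) * complex_of_real (sqrt (g (l j)))"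
      using g[of i] ij by (simp flip: of_real_mult)
    then show ?thesis using True ij by (simp add: b_def)
  next
    case False
    then have "a $ i = 0 \<or> col P i \<bullet>c col P j = 0"
      using hermitian_eigenvectors_orthogonal[OF A _ eig _ eig, of i j] P ij by auto
    then show ?thesis using ij by (auto simp: b_def)
  qed
  have "(P *\<^sub>v vec n (\<lambda>i. complex_of_real (g (l i)) * a $ i)) \<bullet>c (P *\<^sub>v a) = (P *\<^sub>v b) \<bullet>c (P *\<^sub>v b)"
    unfolding mult_mat_vec_cscalar_prod[OF P b b] using a
    by (subst mult_mat_vec_cscalar_prod[OF P]) (auto simp: weight intro!: sum.cong)
  also have "Re \<dots> \<ge> 0" using P b by (subst Re_cscalar_prod_self[of _ n]) (auto intro: sum_nonneg)
  finally show ?thesis .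
qed

lemma mult_mat_vec_eigenvectors:
  fixes A :: "complex mat"
  assumes A: "A \<in> carrier_mat n n" and P: "P \<in> carrier_mat n n"
    and eig: "\<And>i. i < n \<Longrightarrow> A *\<^sub>v col P i = complex_of_real (l i) \<cdot>\<^sub>v col P i"
    and a: "a \<in> carrier_vec n"
  shows "A *\<^sub>v (P *\<^sub>v a) = P *\<^sub>v vec n (\<lambda>i. complex_of_real (l i) * a $ i)"
proof (intro eq_vecI)
  fix r assume r: "r < dim_vec (P *\<^sub>v vec n (\<lambda>i. complex_of_real (l i) * a $ i))"
  have AP: "(A * P) $$ (r, i) = complex_of_real (l i) * P $$ (r, i)" if "i < n" for i
  proof -
    have "(A * P) $$ (r, i) = (A *\<^sub>v col P i) $ r" using A P r that by simp
    then show ?thesis using eig[OF that] P r that by simp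
  qed
  have mult: "(M *\<^sub>v x) $ r = (\<Sum>i<n. M $$ (r, i) * x $ i)"
    if "M \<in> carrier_mat n n" "x \<in> carrier_vec n" for M and x :: "complex vec"
    using that P r by (simp add: scalar_prod_def atLeast0LessThan)
  have "(A *\<^sub>v (P *\<^sub>v a)) $ r = ((A * P) *\<^sub>v a) $ r"
    using A P a by (simp add: assoc_mult_mat_vec[of _ n n _ n])
  also have "\<dots> = (\<Sum>i<n. complex_of_real (l i) * P $$ (r, i) * a $ i)"
    unfolding mult[OF mult_carrier_mat[OF A P] a] by (intro sum.cong) (simp_all only: AP lessThan_iff)
  also have "\<dots> = (P *\<^sub>v vec n (\<lambda>i. complex_of_real (l i) * a $ i)) $ r"
    unfolding mult[OF P vec_carrier] by (intro sum.cong) auto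
  finally show "(A *\<^sub>v (P *\<^sub>v a)) $ r = (P *\<^sub>v vec n (\<lambda>i. complex_of_real (l i) * a $ i)) $ r" .
qed (use A P in auto)

text \<open>On the support of \<open>a\<close> the weights l - c, respectively c - l, are
  nonnegative, so the weighted form is nonnegative; rearranging gives each bound. Restricting to the
  support makes this a statement about spectral subspaces.\<close>

lemma hermitian_rayleigh_bounds:
  fixes A :: "complex mat"
  assumes A: "A \<in> carrier_mat n n" "mat_adjoint A = A" and P: "P \<in> carrier_mat n n"
    and eig: "\<And>i. i < n \<Longrightarrow> A *\<^sub>v col P i = complex_of_real (l i) \<cdot>\<^sub>v col P i"
    and a: "a \<in> carrier_vec n"
  shows "(\<And>i. i < n \<Longrightarrow> a $ i \<noteq> 0 \<Longrightarrow> c \<le> l i) \<Longrightarrow>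
      c * Re ((P *\<^sub>v a) \<bullet>c (P *\<^sub>v a)) \<le> Re ((A *\<^sub>v (P *\<^sub>v a)) \<bullet>c (P *\<^sub>v a))"
    and "(\<And>i. i < n \<Longrightarrow> a $ i \<noteq> 0 \<Longrightarrow> l i \<le> c) \<Longrightarrow>
      Re ((A *\<^sub>v (P *\<^sub>v a)) \<bullet>c (P *\<^sub>v a)) \<le> c * Re ((P *\<^sub>v a) \<bullet>c (P *\<^sub>v a))"
proof -
  have Av: "A *\<^sub>v (P *\<^sub>v a) = P *\<^sub>v vec n (\<lambda>i. complex_of_real (l i) * a $ i)"
    by (rule mult_mat_vec_eigenvectors[OF A(1) P eig a])
  \<comment> \<open>The sign \<open>s\<close> is 1 for the lower and -1 for the upper bound.\<close>
  have split: "Re ((P *\<^sub>v vec n (\<lambda>i. complex_of_real (s * (l i - c)) * a $ i)) \<bullet>c (P *\<^sub>v a))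
      = s * (Re ((A *\<^sub>v (P *\<^sub>v a)) \<bullet>c (P *\<^sub>v a)) - c * Re ((P *\<^sub>v a) \<bullet>c (P *\<^sub>v a)))" for s
  proof -
    have "(P *\<^sub>v vec n (\<lambda>i. complex_of_real (s * (l i - c)) * a $ i)) \<bullet>c (P *\<^sub>v a)
      = complex_of_real s * ((A *\<^sub>v (P *\<^sub>v a)) \<bullet>c (P *\<^sub>v a)
          - complex_of_real c * ((P *\<^sub>v a) \<bullet>c (P *\<^sub>v a)))"
      unfolding Av mult_mat_vec_cscalar_prod[OF P a a] mult_mat_vec_cscalar_prod[OF P vec_carrier a]
        sum_distrib_left sum_subtractf[symmetric]
      by (intro sum.cong) (auto simp: algebra_simps)
    then show ?thesis by simp
  qed
  show "c * Re ((P *\<^sub>v a) \<bullet>c (P *\<^sub>v a)) \<le> Re ((A *\<^sub>v (P *\<^sub>v a)) \<bullet>c (P *\<^sub>v a))"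
    if "\<And>i. i < n \<Longrightarrow> a $ i \<noteq> 0 \<Longrightarrow> c \<le> l i"
    using hermitian_weighted_form_nonneg[OF A P eig a, of "\<lambda>x. 1 * (x - c)"] that split[of 1] by simp
  show "Re ((A *\<^sub>v (P *\<^sub>v a)) \<bullet>c (P *\<^sub>v a)) \<le> c * Re ((P *\<^sub>v a) \<bullet>c (P *\<^sub>v a))"
    if "\<And>i. i < n \<Longrightarrow> a $ i \<noteq> 0 \<Longrightarrow> l i \<le> c"
    using hermitian_weighted_form_nonneg[OF A P eig a, of "\<lambda>x. - 1 * (x - c)"] that split[of "- 1"] by simp
qed

lemma eigvals_desc_antimono:
  assumes "i \<le> j" "j < length (eigvals_desc A)"
  shows "eigvals_desc A ! j \<le> eigvals_desc A ! i"
proof -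
  have "sorted (rev (eigvals_desc A))" by (simp add: eigvals_desc_def)
  then show ?thesis using assms by (simp add: sorted_rev_nth_mono)
qed

text \<open>Both spectral subspaces are intersected by solving one square linear system for the coordinates
  in the eigenbasis of \<open>B\<close>: the rows \<open>i \<ge> k\<close> exclude the small eigenvalues of \<open>B\<close>, the rows
  \<open>i < k - 1\<close> the large ones of \<open>A\<close>, and the zero row in between makes the system singular.\<close>

lemma kth_eigval_mono_form:
  fixes A B :: "complex mat"
  assumes A: "A \<in> carrier_mat n n" "mat_adjoint A = A"
    and B: "B \<in> carrier_mat n n" "mat_adjoint B = B"
    and k: "1 \<le> k" "k \<le> n"
    and form: "\<And>v. v \<in> carrier_vec n \<Longrightarrow>
      Re ((B *\<^sub>v v) \<bullet>c v) \<le> Re ((A *\<^sub>v v) \<bullet>c v) + c * Re (v \<bullet>c v)"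
  shows "kth_eigval k B \<le> kth_eigval k A + c"
proof -
  obtain P Q where P: "P \<in> carrier_mat n n" "Q \<in> carrier_mat n n" "P * Q = 1\<^sub>m n" "Q * P = 1\<^sub>m n"
    and eigA: "\<And>i. i < n \<Longrightarrow> A *\<^sub>v col P i = complex_of_real (eigvals_desc A ! i) \<cdot>\<^sub>v col P i"
    and lenA: "length (eigvals_desc A) = n"
    using hermitian_spectral[OF A] by blast
  obtain R S where R: "R \<in> carrier_mat n n" "S \<in> carrier_mat n n" "R * S = 1\<^sub>m n" "S * R = 1\<^sub>m n"
    and eigB: "\<And>i. i < n \<Longrightarrow> B *\<^sub>v col R i = complex_of_real (eigvals_desc B ! i) \<cdot>\<^sub>v col R i"
    and lenB: "length (eigvals_desc B) = n"
    using hermitian_spectral[OF B] by blast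
  define L where "L = mat\<^sub>r n n (\<lambda>i. if i = k - 1 then 0\<^sub>v n else
    if i < k - 1 then row (Q * R) i else unit_vec n i)"
  have L: "L \<in> carrier_mat n n" by (simp add: L_def)
  have "det L = 0" unfolding L_def using k P R by (intro det_row_0) auto
  then obtain a where a: "a \<in> carrier_vec n" "a \<noteq> 0\<^sub>v n" "L *\<^sub>v a = 0\<^sub>v n"
    using det_0_iff_vec_prod_zero[OF L] by auto
  have La: "row L i \<bullet> a = 0" if "i < n" for i
    using arg_cong[OF a(3), of "\<lambda>v. v $ i"] L that by simp
  define v where "v = R *\<^sub>v a"
  define b where "b = Q *\<^sub>v v"
  have v: "v \<in> carrier_vec n" and b: "b \<in> carrier_vec n" using P R a by (auto simp: v_def b_def)
  have vb: "v = P *\<^sub>v b" using P v by (simp add: b_def flip: assoc_mult_mat_vec[of _ n n _ n])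
  have "a = S *\<^sub>v v" using R a by (simp add: v_def flip: assoc_mult_mat_vec[of _ n n _ n])
  then have "v \<noteq> 0\<^sub>v n" using a(2) R by auto
  then have "Re (v \<bullet>c v) \<noteq> 0"
    using v by (auto simp: Re_cscalar_prod_self sum_nonneg_eq_0_iff)
  then have pos: "Re (v \<bullet>c v) > 0" using v by (simp add: Re_cscalar_prod_self sum_nonneg less_le)
  \<comment> \<open>Lists are indexed from 0, so \<open>kth_eigval k\<close> is entry
    \<open>k - 1\<close>. The vector \<open>v\<close> uses eigenvectors of \<open>B\<close> with
    index at most \<open>k - 1\<close> and eigenvectors of \<open>A\<close> with index at least
    \<open>k - 1\<close>; both ranges include the k-th eigenvalue itself.\<close>
  have a0: "i \<le> k - 1" if "i < n" "a $ i \<noteq> 0" for i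
  proof (rule ccontr)
    assume "\<not> i \<le> k - 1"
    then have "row L i = unit_vec n i" using that unfolding L_def by simp
    then show False using La[OF that(1)] that a(1) by simp
  qed
  have b0: "k - 1 \<le> i" if "i < n" "b $ i \<noteq> 0" for i
  proof (rule ccontr)
    assume "\<not> k - 1 \<le> i"
    then have "row L i = row (Q * R) i" using that P R unfolding L_def by simp
    moreover have "b = (Q * R) *\<^sub>v a" using P R a by (simp add: b_def v_def)
    ultimately show False using La[OF that(1)] that P R by simp
  qed
  have "kth_eigval k B * Re (v \<bullet>c v) \<le> Re ((B *\<^sub>v v) \<bullet>c v)"
    unfolding v_def kth_eigval_def
    using a0 k lenB by (intro hermitian_rayleigh_bounds[OF B R(1) eigB a(1)] eigvals_desc_antimono) auto
  moreover have "Re ((A *\<^sub>v v) \<bullet>c v) \<le> kth_eigval k A * Re (v \<bullet>c v)"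
    unfolding vb kth_eigval_def
    using b0 lenA by (intro hermitian_rayleigh_bounds[OF A P(1) eigA b] eigvals_desc_antimono) auto
  ultimately have "kth_eigval k B * Re (v \<bullet>c v) \<le> (kth_eigval k A + c) * Re (v \<bullet>c v)"
    using form[OF v] by (simp add: algebra_simps)
  then show ?thesis using pos by simp
qed

section \<open>Eigenvalues of sample covariance matrices\<close>

lemma sample_cov_hermitian:
  assumes X: "X \<in> carrier_mat n N"
  shows "mat_adjoint (sample_cov X) = sample_cov X"
proof -
  note S = sample_cov_carrier[OF X]
  have adj: "mat_adjoint (sample_cov X) \<in> carrier_mat n n" using S by (auto simp: mat_adjoint_def)
  show ?thesis
  proof (intro eq_matI)
    fix i j assume "i < dim_row (sample_cov X)" "j < dim_col (sample_cov X)"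
    then have ij: "i < n" "j < n" using S by auto
    then show "mat_adjoint (sample_cov X) $$ (i, j) = sample_cov X $$ (i, j)"
      using S by (subst mat_adjoint_index) (auto simp: sample_cov_index[OF X] mult_ac)
  qed (use S adj in auto)
qed

lemma mult_mat_vec_cscalar_prod_sum:
  fixes A :: "complex mat"
  assumes A: "A \<in> carrier_mat n n" and v: "v \<in> carrier_vec n"
  shows "(A *\<^sub>v v) \<bullet>c v = (\<Sum>i<n. \<Sum>j<n. A $$ (i, j) * (v $ j * cnj (v $ i)))"
  using assms
  by (subst cscalar_prod_sum[OF v])
    (auto simp: scalar_prod_def sum_distrib_right atLeast0LessThan mult.assoc intro!: sum.cong)

text \<open>This is the squared norm of X* v divided by N. It is a sum over the columns of X, so a
  change of one column affects a single summand.\<close>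

lemma sample_cov_form:
  assumes X: "X \<in> carrier_mat n N" and v: "v \<in> carrier_vec n"
  shows "Re ((sample_cov X *\<^sub>v v) \<bullet>c v) =
    (\<Sum>l<N. (cmod (\<Sum>j<n. cnj (X $$ (j, l)) * v $ j))\<^sup>2) / real N"
proof -
  define y where "y = (\<lambda>l. \<Sum>j<n. cnj (X $$ (j, l)) * v $ j)"
  have "(sample_cov X *\<^sub>v v) \<bullet>c v
      = (\<Sum>i<n. \<Sum>j<n. \<Sum>l<N. cnj (cnj (X $$ (i, l)) * v $ i) * (cnj (X $$ (j, l)) * v $ j)) / of_nat N"
    by (subst mult_mat_vec_cscalar_prod_sum[OF sample_cov_carrier[OF X] v])
      (simp add: sample_cov_index[OF X] sum_distrib_right sum_distrib_left sum_divide_distrib mult_ac)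
  also have "\<dots> = (\<Sum>l<N. \<Sum>i<n. \<Sum>j<n. cnj (cnj (X $$ (i, l)) * v $ i) * (cnj (X $$ (j, l)) * v $ j)) / of_nat N"
    by (subst sum.swap, subst (3) sum.swap) (intro arg_cong2[where f = "(/)"] refl sum.cong sum.swap)
  also have "\<dots> = (\<Sum>l<N. cnj (y l) * y l) / of_nat N"
    by (simp add: y_def sum_product)
  also have "\<dots> = complex_of_real ((\<Sum>l<N. (cmod (y l))\<^sup>2) / real N)"
    by (simp add: complex_norm_square mult.commute del: of_real_power)
  finally show ?thesis by (simp add: y_def)
qed

lemma kth_eigval_sample_cov_change_column:
  assumes X: "X \<in> carrier_mat n N" and Y: "Y \<in> carrier_mat n N" and k: "1 \<le> k" "k \<le> n"
    and bound: "\<And>i. i < n \<Longrightarrow> cmod (Y $$ (i, l)) \<le> 1"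
    and eq: "\<And>i j. i < n \<Longrightarrow> j < N \<Longrightarrow> j \<noteq> l \<Longrightarrow> X $$ (i, j) = Y $$ (i, j)"
  shows "kth_eigval k (sample_cov Y) \<le> kth_eigval k (sample_cov X) + real n / real N"
proof (rule kth_eigval_mono_form[OF sample_cov_carrier[OF X] sample_cov_hermitian[OF X]
      sample_cov_carrier[OF Y] sample_cov_hermitian[OF Y] k])
  fix v :: "complex vec" assume v: "v \<in> carrier_vec n"
  define y where "y = (\<lambda>X j. (cmod (\<Sum>i<n. cnj (X $$ (i, j)) * v $ i))\<^sup>2)"
  have "y Y l \<le> (\<Sum>i<n. cmod (v $ i))\<^sup>2"
    unfolding y_def
    by (intro power_mono order_trans[OF norm_sum] sum_mono)
      (use bound in \<open>auto simp: norm_mult intro: mult_left_le_one_le\<close>)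
  also have "\<dots> \<le> real n * (\<Sum>i<n. (cmod (v $ i))\<^sup>2)"
    using sum_squared_le_sum_of_squares[of "\<lambda>i. cmod (v $ i)" "{..<n}"] by (simp add: mult.commute)
  finally have yl: "y Y l \<le> real n * Re (v \<bullet>c v)"
    using Re_cscalar_prod_self[OF v] by simp
  have "y Y j \<le> y X j + (if j = l then real n * Re (v \<bullet>c v) else 0)" if "j < N" for j
    using yl eq[OF _ that] by (auto simp: y_def add_increasing)
  then have "(\<Sum>j<N. y Y j) \<le> (\<Sum>j<N. y X j + (if j = l then real n * Re (v \<bullet>c v) else 0))"
    by (intro sum_mono) auto
  also have "\<dots> \<le> (\<Sum>j<N. y X j) + real n * Re (v \<bullet>c v)"
    using v by (simp add: sum.distrib sum.delta Re_cscalar_prod_self sum_nonneg)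
  finally show "Re ((sample_cov Y *\<^sub>v v) \<bullet>c v)
      \<le> Re ((sample_cov X *\<^sub>v v) \<bullet>c v) + real n / real N * Re (v \<bullet>c v)"
    unfolding sample_cov_form[OF X v] sample_cov_form[OF Y v]
    by (simp add: y_def divide_right_mono flip: add_divide_distrib)
qed

section \<open>Continuity, measurability and boundedness of the eigenvalues\<close>

lemma kth_eigval_entrywise_lipschitz:
  fixes A B :: "complex mat"
  assumes A: "A \<in> carrier_mat n n" "mat_adjoint A = A"
    and B: "B \<in> carrier_mat n n" "mat_adjoint B = B" and k: "1 \<le> k" "k \<le> n"
  shows "\<bar>kth_eigval k A - kth_eigval k B\<bar> \<le> (\<Sum>i<n. \<Sum>j<n. cmod (A $$ (i, j) - B $$ (i, j)))"
proof -
  have le: "kth_eigval k B \<le> kth_eigval k A + (\<Sum>i<n. \<Sum>j<n. cmod (A $$ (i, j) - B $$ (i, j)))"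
    if A: "A \<in> carrier_mat n n" "mat_adjoint A = A" and B: "B \<in> carrier_mat n n" "mat_adjoint B = B"
    for A B :: "complex mat"
  proof (rule kth_eigval_mono_form[OF A B k])
    fix v :: "complex vec" assume v: "v \<in> carrier_vec n"
    \<comment> \<open>By the inequality 2ab \<le> a^2 + b^2, each entry of the difference matrix
      contributes at most its modulus times |v|^2 to the form.\<close>
    have "cmod (v $ i) * cmod (v $ j) \<le> Re (v \<bullet>c v)" if "i < n" "j < n" for i j
    proof -
      have sq: "(cmod (v $ i))\<^sup>2 \<le> Re (v \<bullet>c v)" if "i < n" for i
        unfolding Re_cscalar_prod_self[OF v] using that by (intro member_le_sum) auto
      have "2 * (cmod (v $ i) * cmod (v $ j)) \<le> (cmod (v $ i))\<^sup>2 + (cmod (v $ j))\<^sup>2"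
        using sum_squares_bound[of "cmod (v $ i)" "cmod (v $ j)"] by simp
      then show ?thesis using sq[OF that(1)] sq[OF that(2)] by linarith
    qed
    then have entry: "cmod ((B $$ (i, j) - A $$ (i, j)) * (v $ j * cnj (v $ i)))
        \<le> cmod (A $$ (i, j) - B $$ (i, j)) * Re (v \<bullet>c v)" if "i < n" "j < n" for i j
      using that by (auto simp: norm_mult norm_minus_commute[of "B $$ (i, j)"] intro!: mult_left_mono)
    have "(B *\<^sub>v v) \<bullet>c v - (A *\<^sub>v v) \<bullet>c v
        = (\<Sum>i<n. \<Sum>j<n. (B $$ (i, j) - A $$ (i, j)) * (v $ j * cnj (v $ i)))"
      unfolding mult_mat_vec_cscalar_prod_sum[OF A(1) v] mult_mat_vec_cscalar_prod_sum[OF B(1) v]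
      by (simp add: left_diff_distrib sum_subtractf)
    then have "Re ((B *\<^sub>v v) \<bullet>c v) - Re ((A *\<^sub>v v) \<bullet>c v)
        \<le> cmod (\<Sum>i<n. \<Sum>j<n. (B $$ (i, j) - A $$ (i, j)) * (v $ j * cnj (v $ i)))"
      by (metis complex_Re_le_cmod minus_complex.sel(1))
    also have "\<dots> \<le> (\<Sum>i<n. \<Sum>j<n. cmod (A $$ (i, j) - B $$ (i, j)) * Re (v \<bullet>c v))"
      by (intro order_trans[OF norm_sum] sum_mono) (use entry in auto)
    finally show "Re ((B *\<^sub>v v) \<bullet>c v) \<le> Re ((A *\<^sub>v v) \<bullet>c v) +
        (\<Sum>i<n. \<Sum>j<n. cmod (A $$ (i, j) - B $$ (i, j))) * Re (v \<bullet>c v)"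
      by (simp add: sum_distrib_right)
  qed
  show ?thesis
    using le[OF A B] le[OF B A] by (simp add: norm_minus_commute[of "B $$ _"])
qed

text \<open>Continuity is in the product topology on entry functions: the entries of the covariance
  matrix depend continuously on finitely many coordinates, and the entrywise Lipschitz bound passes
  this on to the eigenvalue.\<close>

lemma continuous_kth_eigval_sample_cov:
  fixes k n N :: nat
  assumes k: "1 \<le> k" "k \<le> n"
  shows "continuous_on UNIV (\<lambda>x. kth_eigval k (sample_cov (mat n N x)))"
proof (rule continuous_at_imp_continuous_on, intro ballI)
  fix x :: "nat \<times> nat \<Rightarrow> complex"
  let ?S = "\<lambda>x i j. 1 / of_nat N * (\<Sum>l<N. x (i, l) * cnj (x (j, l)))"
  define H where "H = (\<lambda>y. \<Sum>i<n. \<Sum>j<n. cmod (?S y i j - ?S x i j))"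
  have "continuous_on UNIV H"
    unfolding H_def by (intro continuous_intros continuous_on_product_coordinates)
  then have "(H \<longlongrightarrow> H x) (at x)" by (simp add: continuous_on_def)
  moreover have "H x = 0" by (simp add: H_def)
  ultimately have H0: "(H \<longlongrightarrow> 0) (at x)" by simp
  let ?G = "\<lambda>x. kth_eigval k (sample_cov (mat n N x))"
  have "\<bar>?G y - ?G x\<bar> \<le> H y" for y
  proof -
    note c = mat_carrier[of n N]
    have "\<bar>?G y - ?G x\<bar>
      \<le> (\<Sum>i<n. \<Sum>j<n. cmod (sample_cov (mat n N y) $$ (i, j) - sample_cov (mat n N x) $$ (i, j)))"
      by (intro kth_eigval_entrywise_lipschitz sample_cov_carrier[OF c] sample_cov_hermitian[OF c] k)
    also have "\<dots> = H y"
      unfolding H_def by (intro sum.cong refl) (simp add: sample_cov_index[OF c])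
    finally show ?thesis .
  qed
  then have "((\<lambda>y. ?G y - ?G x) \<longlongrightarrow> 0) (at x)"
    by (intro Lim_null_comparison[OF _ H0]) auto
  then show "isCont ?G x" by (simp add: isCont_def LIM_zero_iff)
qed

lemma measurable_kth_eigval_sample_cov:
  fixes k n N :: nat
  assumes k: "1 \<le> k" "k \<le> n"
    and f: "\<And>i j. i < n \<Longrightarrow> j < N \<Longrightarrow> (\<lambda>w. f w (i, j)) \<in> borel_measurable M"
  shows "(\<lambda>w. kth_eigval k (sample_cov (mat n N (f w)))) \<in> borel_measurable M"
proof -
  \<comment> \<open>Measurability into the product space concerns every coordinate, so those outside
    the matrix are set to 0; the matrix itself is unchanged.\<close>
  let ?f = "\<lambda>w p. if p \<in> {..<n} \<times> {..<N} then f w p else 0"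
  have "?f \<in> borel_measurable M"
  proof (rule measurable_coordinatewise_then_product)
    show "(\<lambda>w. ?f w p) \<in> borel_measurable M" for p
      using f by (cases "p \<in> {..<n} \<times> {..<N}") auto
  qed
  then have "(\<lambda>w. kth_eigval k (sample_cov (mat n N (?f w)))) \<in> borel_measurable M"
    by (intro measurable_compose[OF _ borel_measurable_continuous_onI[OF continuous_kth_eigval_sample_cov[OF k]]])
  moreover have "mat n N (?f w) = mat n N (f w)" for w by (intro eq_matI) auto
  ultimately show ?thesis by simp
qed

text \<open>Comparison with the zero matrix: each of the n^2 covariance entries has modulus at most
  1. Some finite bound is all that integrability requires, so the eigenvalue at zero is left
  unevaluated.\<close>

lemma kth_eigval_sample_cov_bounded:
  assumes X: "X \<in> carrier_mat n N" and k: "1 \<le> k" "k \<le> n"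
    and bound: "\<And>i j. i < n \<Longrightarrow> j < N \<Longrightarrow> cmod (X $$ (i, j)) \<le> 1"
  shows "\<bar>kth_eigval k (sample_cov X)\<bar> \<le> \<bar>kth_eigval k (sample_cov (0\<^sub>m n N))\<bar> + real n * real n"
proof -
  have Z: "0\<^sub>m n N \<in> carrier_mat n N" by simp
  have "cmod (sample_cov X $$ (i, j) - sample_cov (0\<^sub>m n N) $$ (i, j)) \<le> 1" if ij: "i < n" "j < n" for i j
  proof -
    have "cmod (\<Sum>l<N. X $$ (i, l) * cnj (X $$ (j, l))) \<le> (\<Sum>l<N. 1)"
      by (intro order_trans[OF norm_sum] sum_mono)
        (use bound ij in \<open>auto simp: norm_mult intro: mult_le_one\<close>)
    moreover have "sample_cov (0\<^sub>m n N) $$ (i, j) = 0"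
      using ij by (simp add: sample_cov_index[OF Z])
    ultimately show ?thesis
      using ij by (cases "N = 0") (simp_all add: sample_cov_index[OF X] norm_divide divide_le_eq_1)
  qed
  then have "(\<Sum>i<n. \<Sum>j<n. cmod (sample_cov X $$ (i, j) - sample_cov (0\<^sub>m n N) $$ (i, j)))
      \<le> (\<Sum>i<n. \<Sum>j<n. 1)"
    by (intro sum_mono) auto
  then have "\<bar>kth_eigval k (sample_cov X) - kth_eigval k (sample_cov (0\<^sub>m n N))\<bar> \<le> real n * real n"
    using kth_eigval_entrywise_lipschitz[OF sample_cov_carrier[OF X] sample_cov_hermitian[OF X]
      sample_cov_carrier[OF Z] sample_cov_hermitian[OF Z] k] by simp
  then show ?thesis by linarith
qed

section \<open>Bounded differences\<close>

text \<open>The range of \<open>f\<close> in one coordinate is only enclosed in an interval of length \<open>2 * c i\<close>, which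
  loses a factor 4 in the exponent against McDiarmid's constant.\<close>

lemma (in product_prob_space) bounded_differences_mgf:
  fixes f :: "('i \<Rightarrow> 'a) \<Rightarrow> real" and c :: "'i \<Rightarrow> real"
  assumes "finite J" "f \<in> borel_measurable (PiM J M)" and "s > 0"
    and "\<And>x. x \<in> space (PiM J M) \<Longrightarrow> \<bar>f x\<bar> \<le> C"
    and "\<And>x i y. x \<in> space (PiM J M) \<Longrightarrow> i \<in> J \<Longrightarrow> y \<in> space (M i) \<Longrightarrow> \<bar>f (x(i := y)) - f x\<bar> \<le> c i"
  shows "(\<integral>\<^sup>+x. exp (s * (f x - (\<integral>x. f x \<partial>PiM J M))) \<partial>PiM J M)
    \<le> ennreal (exp (s\<^sup>2 * (\<Sum>i\<in>J. (c i)\<^sup>2) / 2))"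
  using assms
proof (induction J arbitrary: f rule: finite_induct)
  case empty
  interpret E: prob_space "PiM {} M" by (rule prob_space_PiM) (rule prob_space)
  \<comment> \<open>The empty product has a single point, so \<open>f\<close> equals its mean and
    the exponent is 0.\<close>
  have "(\<integral>x. f x \<partial>PiM {} M) = (\<integral>x. f (\<lambda>_. undefined) \<partial>PiM {} M)"
    by (intro Bochner_Integration.integral_cong refl) (simp add: space_PiM)
  then have "(\<integral>x. f x \<partial>PiM {} M) = f (\<lambda>_. undefined)" by (simp add: E.prob_space)
  then have "(\<integral>\<^sup>+x. exp (s * (f x - (\<integral>x. f x \<partial>PiM {} M))) \<partial>PiM {} M) = (\<integral>\<^sup>+x. 1 \<partial>PiM {} M)"
    by (intro nn_integral_cong) (simp add: space_PiM)
  then show ?case by (simp add: E.emeasure_space_1)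
next
  case (insert i K)
  note f[measurable] = insert.prems(1)
  interpret PK: prob_space "PiM K M" by (rule prob_space_PiM) (rule prob_space)
  interpret PiK: prob_space "PiM (insert i K) M" by (rule prob_space_PiM) (rule prob_space)
  have upd: "x(i := y) \<in> space (PiM (insert i K) M)" if "x \<in> space (PiM K M)" "y \<in> space (M i)" for x y
    using that insert.hyps by (auto simp: space_PiM PiE_iff extensional_def)
  have fxy: "\<bar>f (x(i := y))\<bar> \<le> C" if "x \<in> space (PiM K M)" "y \<in> space (M i)" for x y
    using insert.prems(3)[OF upd[OF that]] .
  have upd_meas: "(\<lambda>(x, y). f (x(i := y))) \<in> borel_measurable (PiM K M \<Otimes>\<^sub>M M i)"
    using measurable_compose[OF measurable_add_dim f] by (simp add: case_prod_beta')
  have fi: "(\<lambda>y. f (x(i := y))) \<in> borel_measurable (M i)" if "x \<in> space (PiM K M)" for x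
    using measurable_Pair2[OF upd_meas that] by simp
  have int_i: "integrable (M i) (\<lambda>y. f (x(i := y)))" if "x \<in> space (PiM K M)" for x
    using fxy[OF that] fi[OF that] by (intro M.integrable_const_bound[of _ C]) auto
  \<comment> \<open>\<open>g\<close> averages out coordinate \<open>i\<close>. It keeps the mean,
    the bound \<open>C\<close> and the difference bounds of \<open>f\<close> in the other
    coordinates, so the induction hypothesis applies to it.\<close>
  define g where "g = (\<lambda>x. \<integral>y. f (x(i := y)) \<partial>M i)"
  have g[measurable]: "g \<in> borel_measurable (PiM K M)"
    unfolding g_def by (rule M.borel_measurable_lebesgue_integral) (rule upd_meas)
  have int_f: "integrable (PiM (insert i K) M) f"
    using insert.prems(3) f by (intro PiK.integrable_const_bound[of _ C]) auto
  define E where "E = (\<integral>x. f x \<partial>PiM (insert i K) M)"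
  have E: "(\<integral>x. g x \<partial>PiM K M) = E"
    unfolding E_def g_def using product_integral_insert[OF insert.hyps int_f] by simp
  have gb: "\<bar>g x\<bar> \<le> C" if x: "x \<in> space (PiM K M)" for x
  proof -
    have "\<bar>g x\<bar> \<le> (\<integral>y. \<bar>f (x(i := y))\<bar> \<partial>M i)"
      unfolding g_def by (rule integral_abs_bound)
    also have "\<dots> \<le> (\<integral>y. C \<partial>M i)"
      using fxy[OF x] int_i[OF x] by (intro integral_mono) auto
    finally show ?thesis by (simp add: M.prob_space)
  qed
  have gd: "\<bar>g (x(j := z)) - g x\<bar> \<le> c j"
    if x: "x \<in> space (PiM K M)" and j: "j \<in> K" and z: "z \<in> space (M j)" for x j z
  proof -
    have ij: "i \<noteq> j" using insert.hyps j by auto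
    have x': "x(j := z) \<in> space (PiM K M)" using x j z by (auto simp: space_PiM PiE_iff extensional_def)
    have "g (x(j := z)) - g x = (\<integral>y. f ((x(j := z))(i := y)) - f (x(i := y)) \<partial>M i)"
      unfolding g_def using int_i[OF x] int_i[OF x'] by simp
    also have "\<bar>\<dots>\<bar> \<le> (\<integral>y. \<bar>f ((x(j := z))(i := y)) - f (x(i := y))\<bar> \<partial>M i)"
      by (rule integral_abs_bound)
    also have "\<dots> \<le> (\<integral>y. c j \<partial>M i)"
    proof (rule integral_mono)
      fix y assume y: "y \<in> space (M i)"
      have "\<bar>f ((x(i := y))(j := z)) - f (x(i := y))\<bar> \<le> c j"
        using j z by (intro insert.prems(4) upd x y) auto
      then show "\<bar>f ((x(j := z))(i := y)) - f (x(i := y))\<bar> \<le> c j"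
        unfolding fun_upd_twist[OF ij] .
    qed (use int_i[OF x] int_i[OF x'] in auto)
    finally show ?thesis by (simp add: M.prob_space)
  qed
  \<comment> \<open>For fixed \<open>x\<close> the function of \<open>y\<close> has mean
    \<open>g x\<close> and stays within \<open>c i\<close> of its value at a reference point
    \<open>y0\<close>. Hoeffding's lemma for an interval of length L = 2 c gives the exponent s^2
    L^2 / 8 = s^2 c^2 / 2.\<close>
  have inner: "(\<integral>\<^sup>+y. exp (s * (f (x(i := y)) - g x)) \<partial>M i) \<le> ennreal (exp (s\<^sup>2 * (c i)\<^sup>2 / 2))"
    if x: "x \<in> space (PiM K M)" for x
  proof -
    obtain y0 where y0: "y0 \<in> space (M i)" using M.not_empty by auto
    have range: "f (x(i := y)) \<in> {f (x(i := y0)) - c i..f (x(i := y0)) + c i}" if "y \<in> space (M i)" for y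
    proof -
      have "\<bar>f ((x(i := y0))(i := y)) - f (x(i := y0))\<bar> \<le> c i"
        using that by (intro insert.prems(4) upd x y0) auto
      then have "\<bar>f (x(i := y)) - f (x(i := y0))\<bar> \<le> c i" unfolding fun_upd_upd .
      then show ?thesis by (simp add: abs_le_iff)
    qed
    interpret H: interval_bounded_random_variable "M i" "\<lambda>y. f (x(i := y))"
      "f (x(i := y0)) - c i" "f (x(i := y0)) + c i"
      by unfold_locales (use range fi[OF x] in auto)
    show ?thesis
      using H.Hoeffdings_lemma_nn_integral[OF \<open>s > 0\<close>] by (simp add: g_def power_mult_distrib)
  qed
  have "(\<integral>\<^sup>+x. exp (s * (f x - E)) \<partial>PiM (insert i K) M)
      = (\<integral>\<^sup>+x. (\<integral>\<^sup>+y. exp (s * (f (x(i := y)) - E)) \<partial>M i) \<partial>PiM K M)"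
    using insert.hyps by (subst product_nn_integral_insert) auto
  \<comment> \<open>Split f - E = (g - E) + (f - g); the first part is constant in the inner
    integral.\<close>
  also have "\<dots> = (\<integral>\<^sup>+x. ennreal (exp (s * (g x - E))) * (\<integral>\<^sup>+y. exp (s * (f (x(i := y)) - g x)) \<partial>M i) \<partial>PiM K M)"
  proof (intro nn_integral_cong)
    fix x assume x: "x \<in> space (PiM K M)"
    have "(\<integral>\<^sup>+y. exp (s * (f (x(i := y)) - E)) \<partial>M i)
      = (\<integral>\<^sup>+y. ennreal (exp (s * (g x - E))) * exp (s * (f (x(i := y)) - g x)) \<partial>M i)"
      by (intro nn_integral_cong) (simp add: right_diff_distrib exp_diff flip: ennreal_mult')
    then show "(\<integral>\<^sup>+y. exp (s * (f (x(i := y)) - E)) \<partial>M i)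
      = ennreal (exp (s * (g x - E))) * (\<integral>\<^sup>+y. exp (s * (f (x(i := y)) - g x)) \<partial>M i)"
      using fi[OF x] by (simp add: nn_integral_cmult)
  qed
  also have "\<dots> \<le> (\<integral>\<^sup>+x. ennreal (exp (s * (g x - E))) * ennreal (exp (s\<^sup>2 * (c i)\<^sup>2 / 2)) \<partial>PiM K M)"
    by (intro nn_integral_mono mult_left_mono inner) auto
  also have "\<dots> = (\<integral>\<^sup>+x. ennreal (exp (s * (g x - E))) \<partial>PiM K M) * ennreal (exp (s\<^sup>2 * (c i)\<^sup>2 / 2))"
    by (intro nn_integral_multc) auto
  also have "\<dots> \<le> ennreal (exp (s\<^sup>2 * (\<Sum>i\<in>K. (c i)\<^sup>2) / 2)) * ennreal (exp (s\<^sup>2 * (c i)\<^sup>2 / 2))"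
    using insert.IH[OF g \<open>s > 0\<close> gb gd] unfolding E by (intro mult_right_mono) auto
  also have "\<dots> = ennreal (exp (s\<^sup>2 * (\<Sum>i\<in>insert i K. (c i)\<^sup>2) / 2))"
    using insert.hyps by (simp add: distrib_left add_divide_distrib exp_add mult.commute flip: ennreal_mult')
  finally show ?case unfolding E_def .
qed

text \<open>Chernoff's method applied to the bound on the moment generating function. The positive
  upper bound \<open>V\<close> for the sum of squares keeps the parameter t / V meaningful even if
  all \<open>c i\<close> vanish.\<close>

lemma (in product_prob_space) bounded_differences_concentration:
  fixes f :: "('i \<Rightarrow> 'a) \<Rightarrow> real" and c :: "'i \<Rightarrow> real"
  assumes J: "finite J" and f: "f \<in> borel_measurable (PiM J M)"
    and bound: "\<And>x. x \<in> space (PiM J M) \<Longrightarrow> \<bar>f x\<bar> \<le> C"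
    and diff: "\<And>x i y. x \<in> space (PiM J M) \<Longrightarrow> i \<in> J \<Longrightarrow> y \<in> space (M i) \<Longrightarrow> \<bar>f (x(i := y)) - f x\<bar> \<le> c i"
    and V: "V > 0" "(\<Sum>i\<in>J. (c i)\<^sup>2) \<le> V" and t: "t \<ge> 0"
  shows "measure (PiM J M) {x \<in> space (PiM J M). f x - (\<integral>x. f x \<partial>PiM J M) \<ge> t} \<le> exp (- (t\<^sup>2 / (2 * V)))"
proof (cases "t = 0")
  \<comment> \<open>At t = 0 the claimed bound is 1, while the Chernoff parameter would not be
    positive.\<close>
  case True
  interpret PJ: prob_space "PiM J M" by (rule prob_space_PiM) (rule prob_space)
  show ?thesis using True by simp
next
  case False
  interpret PJ: prob_space "PiM J M" by (rule prob_space_PiM) (rule prob_space)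
  note f[measurable]
  let ?E = "\<integral>x. f x \<partial>PiM J M"
  \<comment> \<open>This value minimises the exponent - s t + s^2 V / 2.\<close>
  define s where "s = t / V"
  have s: "s > 0" using t False V by (simp add: s_def)
  have "ennreal (PJ.prob {x \<in> space (PiM J M). f x - ?E \<ge> t})
      \<le> ennreal (exp (- s * t)) * (\<integral>\<^sup>+x\<in>space (PiM J M). exp (s * (f x - ?E)) \<partial>PiM J M)"
    unfolding PJ.emeasure_eq_measure[symmetric]
    by (intro Chernoff_ineq_nn_integral_ge s) auto
  also have "(\<integral>\<^sup>+x\<in>space (PiM J M). exp (s * (f x - ?E)) \<partial>PiM J M) = (\<integral>\<^sup>+x. exp (s * (f x - ?E)) \<partial>PiM J M)"
    by (intro nn_integral_cong) auto
  also have "\<dots> \<le> ennreal (exp (s\<^sup>2 * (\<Sum>i\<in>J. (c i)\<^sup>2) / 2))"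
    by (rule bounded_differences_mgf[OF J f s bound diff])
  also have "\<dots> \<le> ennreal (exp (s\<^sup>2 * V / 2))"
    using V by (intro ennreal_leI) (auto intro!: mult_left_mono)
  also have "ennreal (exp (- s * t)) * \<dots> = ennreal (exp (- (t\<^sup>2 / (2 * V))))"
  proof -
    have "- s * t + s\<^sup>2 * V / 2 = - (t\<^sup>2 / (2 * V))"
      using V by (simp add: s_def field_simps power2_eq_square)
    then show ?thesis by (simp flip: ennreal_mult' exp_add)
  qed
  finally show ?thesis by (simp add: mult_left_mono)
qed

text \<open>By independence the joint law of the variables is the product of their laws, so
  probability and expectation can be computed on the product space.\<close>

lemma (in prob_space) indep_vars_bounded_differences:
  fixes f :: "('i \<Rightarrow> 'b) \<Rightarrow> real" and c :: "'i \<Rightarrow> real"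
  assumes J: "finite J" "J \<noteq> {}" and indep: "indep_vars M' Y J"
    and f: "f \<in> borel_measurable (PiM J M')"
    and bound: "\<And>x. x \<in> space (PiM J M') \<Longrightarrow> \<bar>f x\<bar> \<le> C"
    and diff: "\<And>x i y. x \<in> space (PiM J M') \<Longrightarrow> i \<in> J \<Longrightarrow> y \<in> space (M' i) \<Longrightarrow> \<bar>f (x(i := y)) - f x\<bar> \<le> c i"
    and V: "V > 0" "(\<Sum>i\<in>J. (c i)\<^sup>2) \<le> V" and t: "t \<ge> 0"
  shows "prob {\<omega> \<in> space M. f (\<lambda>j\<in>J. Y j \<omega>) - expectation (\<lambda>\<omega>. f (\<lambda>j\<in>J. Y j \<omega>)) \<ge> t}
    \<le> exp (- (t\<^sup>2 / (2 * V)))"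
proof -
  have Y: "Y j \<in> measurable M (M' j)" if "j \<in> J" for j
    using indep that by (auto simp: indep_vars_def)
  obtain j0 where j0: "j0 \<in> J" using J by auto
  \<comment> \<open>A product probability space has a probability measure at every index; outside
    \<open>J\<close> the law of \<open>Y j0\<close> serves as a default.\<close>
  define D where "D = (\<lambda>j. let i = if j \<in> J then j else j0 in distr M (M' i) (Y i))"
  have D: "D j = distr M (M' j) (Y j)" if "j \<in> J" for j using that by (simp add: D_def)
  have "prob_space (D j)" for j
    unfolding D_def Let_def using Y j0 by (intro prob_space_distr) auto
  then interpret D: product_prob_space D J by (rule product_prob_spaceI)
  let ?T = "\<lambda>\<omega>. \<lambda>j\<in>J. Y j \<omega>"
  have T: "?T \<in> measurable M (PiM J M')" using Y by (intro measurable_restrict)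
  have distr: "distr M (PiM J M') ?T = PiM J D"
    using indep_vars_iff_distr_eq_PiM'[THEN iffD1, OF J(2) Y indep] D
    by (simp cong: PiM_cong)
  have sets: "sets (PiM J D) = sets (PiM J M')" by (intro sets_PiM_cong) (auto simp: D)
  have space: "space (PiM J D) = space (PiM J M')" by (rule sets_eq_imp_space_eq[OF sets])
  have spaceD: "space (D j) = space (M' j)" if "j \<in> J" for j by (simp add: D that)
  have E: "(\<integral>x. f x \<partial>PiM J D) = expectation (\<lambda>\<omega>. f (?T \<omega>))"
    unfolding distr[symmetric] by (rule integral_distr[OF T f])
  have "prob {\<omega> \<in> space M. f (?T \<omega>) - expectation (\<lambda>\<omega>. f (?T \<omega>)) \<ge> t}
    = measure (PiM J D) {x \<in> space (PiM J D). f x - (\<integral>x. f x \<partial>PiM J D) \<ge> t}"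
  proof -
    have "{x \<in> space (PiM J M'). f x - expectation (\<lambda>\<omega>. f (?T \<omega>)) \<ge> t} \<in> sets (PiM J M')"
      using f by measurable
    then show ?thesis
      unfolding E space unfolding distr[symmetric] using T measurable_space[OF T]
      by (subst measure_distr) (auto intro!: arg_cong[where f = prob])
  qed
  also have "\<dots> \<le> exp (- (t\<^sup>2 / (2 * V)))"
    using f bound diff
    by (intro D.bounded_differences_concentration[OF J(1) _ _ _ V t])
      (auto simp: space spaceD measurable_cong_sets[OF sets refl])
  finally show ?thesis .
qed

section \<open>Concentration of the eigenvalues from independent columns\<close>

theorem theorem2:
  fixes M :: "'w measure"
    and X :: "'w \<Rightarrow> complex mat"
    and n N k :: nat
    and t :: real
  assumes "prob_space M"
    and "n \<ge> 1" and "N \<ge> 1"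
    and "\<And>\<omega>. \<omega> \<in> space M \<Longrightarrow> X \<omega> \<in> carrier_mat n N"
    and "prob_space.indep_vars M (\<lambda>_. borel) (\<lambda>(i, j) \<omega>. X \<omega> $$ (i, j)) ({..<n} \<times> {..<N})"
    and "\<And>i j. i < n \<Longrightarrow> j < N \<Longrightarrow> AE \<omega> in M. cmod (X \<omega> $$ (i, j)) \<le> 1"
    and "1 \<le> k" and "k \<le> n"
    and "t \<ge> 0"
  shows "let lam = (\<lambda>\<omega>. kth_eigval k (sample_cov (X \<omega>)));
             Elam = prob_space.expectation M lam
         in prob_space.prob M {\<omega> \<in> space M. lam \<omega> - Elam \<ge> t}
              \<le> exp (- (real N * t\<^sup>2 / (2 * (real n)\<^sup>2))) \<and>
            prob_space.prob M {\<omega> \<in> space M. lam \<omega> - Elam \<le> - t}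
              \<le> exp (- (real N * t\<^sup>2 / (2 * (real n)\<^sup>2)))"
proof -
  interpret prob_space M by fact
  note k = assms(7,8)
  \<comment> \<open>The entries are bounded only almost surely, but bounded differences are required
    at every point. Truncation to the unit disc, with default value 0, provides this.\<close>
  define h where "h = (\<lambda>z::complex. if cmod z \<le> 1 then z else 0)"
  have h: "cmod (h z) \<le> 1" for z by (simp add: h_def)
  have [measurable]: "h \<in> borel_measurable borel" unfolding h_def by measurable
  \<comment> \<open>\<open>K j\<close> holds the positions of column \<open>j\<close> and
    \<open>Y j\<close> is that column as a random function. These position sets are disjoint, so
    independence of the entries makes the columns independent.\<close>
  define K where "K = (\<lambda>j::nat. {..<n} \<times> {j})"
  define M' where "M' = (\<lambda>j. PiM (K j) (\<lambda>_. borel :: complex measure))"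
  define Y where "Y = (\<lambda>j \<omega>. restrict (\<lambda>p. (case p of (i, j) \<Rightarrow> \<lambda>\<omega>. X \<omega> $$ (i, j)) \<omega>) (K j))"
  have indep: "indep_vars M' Y {..<N}"
    unfolding M'_def Y_def
    by (rule indep_vars_restrict[OF assms(5)]) (auto simp: K_def disjoint_family_on_def)
  have X_meas: "(\<lambda>\<omega>. X \<omega> $$ (i, j)) \<in> borel_measurable M" if "i < n" "j < N" for i j
    using assms(5) that unfolding indep_vars_def by force
  define A where "A = (\<lambda>x::nat \<Rightarrow> nat \<times> nat \<Rightarrow> complex. mat n N (\<lambda>(i, j). h (x j (i, j))))"
  define F where "F = (\<lambda>x. kth_eigval k (sample_cov (A x)))"
  have A: "A x \<in> carrier_mat n N" for x by (simp add: A_def)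
  have F: "F \<in> borel_measurable (PiM {..<N} M')"
    unfolding F_def A_def
  proof (rule measurable_kth_eigval_sample_cov[OF k])
    fix i j assume ij: "i < n" "j < N"
    have "(\<lambda>x. x j) \<in> measurable (PiM {..<N} M') (M' j)"
      using ij by (intro measurable_component_singleton) auto
    moreover have "(\<lambda>y. y (i, j)) \<in> measurable (M' j) borel"
      unfolding M'_def using ij by (intro measurable_component_singleton) (auto simp: K_def)
    ultimately have "(\<lambda>x. x j (i, j)) \<in> borel_measurable (PiM {..<N} M')"
      by (rule measurable_compose)
    then show "(\<lambda>w. case (i, j) of (i, j) \<Rightarrow> h (w j (i, j))) \<in> borel_measurable (PiM {..<N} M')"
      by simp
  qed
  obtain C where bound: "\<And>x. \<bar>F x\<bar> \<le> C"
    unfolding F_def using kth_eigval_sample_cov_bounded[OF A k] h by (auto simp: A_def)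
  \<comment> \<open>The truncated old and new columns are both bounded by 1, so the one-sided
    estimate applies in either direction.\<close>
  have diff: "\<bar>F (x(l := y)) - F x\<bar> \<le> real n / real N" if "l < N" for x l y
  proof -
    have "F (x(l := y)) \<le> F x + real n / real N"
      unfolding F_def
      by (rule kth_eigval_sample_cov_change_column[OF A A k, of _ l]) (use that in \<open>auto simp: A_def h\<close>)
    moreover have "F x \<le> F (x(l := y)) + real n / real N"
      unfolding F_def
      by (rule kth_eigval_sample_cov_change_column[OF A A k, of _ l]) (use that in \<open>auto simp: A_def h\<close>)
    ultimately show ?thesis by linarith
  qed
  \<comment> \<open>N columns each contribute (n / N)^2.\<close>
  define V where "V = (real n)\<^sup>2 / real N"
  have V: "V > 0" "(\<Sum>l<N. (real n / real N)\<^sup>2) \<le> V"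
    using assms(2,3) by (auto simp: V_def power2_eq_square)
  define T where "T = (\<lambda>\<omega>. \<lambda>j\<in>{..<N}. Y j \<omega>)"
  have J: "finite {..<N}" "{..<N} \<noteq> {}" using assms(3) by (auto simp: lessThan_empty_iff)
  define lam where "lam = (\<lambda>\<omega>. kth_eigval k (sample_cov (X \<omega>)))"
  have lam[measurable]: "lam \<in> borel_measurable M"
  proof -
    have "(\<lambda>\<omega>. kth_eigval k (sample_cov (mat n N (\<lambda>p. X \<omega> $$ p)))) \<in> borel_measurable M"
      using X_meas by (rule measurable_kth_eigval_sample_cov[OF k])
    moreover have "mat n N (\<lambda>p. X \<omega> $$ p) = X \<omega>" if "\<omega> \<in> space M" for \<omega>
      using assms(4)[OF that] by (intro eq_matI) auto
    ultimately show ?thesis unfolding lam_def by (simp cong: measurable_cong)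
  qed
  have FT[measurable]: "(\<lambda>\<omega>. F (T \<omega>)) \<in> borel_measurable M"
  proof -
    have "T \<in> measurable M (PiM {..<N} M')"
      using indep unfolding T_def indep_vars_def by (intro measurable_restrict) auto
    then show ?thesis using F by (rule measurable_compose)
  qed
  \<comment> \<open>Almost surely all entries lie in the unit disc, where \<open>h\<close> is the
    identity, so reassembling the columns gives back the original matrix.\<close>
  have ae: "AE \<omega> in M. F (T \<omega>) = lam \<omega>"
  proof -
    have "AE \<omega> in M. \<forall>p\<in>{..<n} \<times> {..<N}. cmod (X \<omega> $$ p) \<le> 1"
      using assms(6) by (intro AE_finite_allI) auto
    then show ?thesis
    proof (rule AE_mp, intro AE_I2 impI)
      fix \<omega> assume "\<omega> \<in> space M" "\<forall>p\<in>{..<n} \<times> {..<N}. cmod (X \<omega> $$ p) \<le> 1"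
      then have "A (T \<omega>) = X \<omega>"
        using assms(4)[of \<omega>] by (intro eq_matI) (auto simp: A_def T_def Y_def K_def h_def)
      then show "F (T \<omega>) = lam \<omega>" by (simp add: F_def lam_def)
    qed
  qed
  have E: "expectation (\<lambda>\<omega>. F (T \<omega>)) = expectation lam"
    using ae by (intro integral_cong_AE) auto
  have exponent: "t\<^sup>2 / (2 * V) = real N * t\<^sup>2 / (2 * (real n)\<^sup>2)" by (simp add: V_def)
  have "prob {\<omega> \<in> space M. lam \<omega> - expectation lam \<ge> t}
      = prob {\<omega> \<in> space M. F (T \<omega>) - expectation (\<lambda>\<omega>. F (T \<omega>)) \<ge> t}"
    unfolding E by (rule finite_measure_eq_AE) (use ae in auto)
  also have "\<dots> \<le> exp (- (t\<^sup>2 / (2 * V)))"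
    unfolding T_def
    by (rule indep_vars_bounded_differences[OF J indep F bound _ V assms(9)]) (simp add: diff)
  finally have upper: "prob {\<omega> \<in> space M. lam \<omega> - expectation lam \<ge> t} \<le> exp (- (t\<^sup>2 / (2 * V)))" .
  \<comment> \<open>The lower tail is the upper tail of \<open>- F\<close>, which has the same
    bounded differences.\<close>
  have "prob {\<omega> \<in> space M. lam \<omega> - expectation lam \<le> - t}
      = prob {\<omega> \<in> space M. - F (T \<omega>) - expectation (\<lambda>\<omega>. - F (T \<omega>)) \<ge> t}"
    unfolding Bochner_Integration.integral_minus E by (rule finite_measure_eq_AE) (use ae in auto)
  also have "\<dots> \<le> exp (- (t\<^sup>2 / (2 * V)))"
    unfolding T_def
    by (rule indep_vars_bounded_differences[where f = "\<lambda>x. - F x", OF J indep _ _ _ V assms(9)])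
      (use F bound diff in \<open>auto simp: abs_minus_commute\<close>)
  finally have "prob {\<omega> \<in> space M. lam \<omega> - expectation lam \<le> - t} \<le> exp (- (t\<^sup>2 / (2 * V)))" .
  with upper show ?thesis unfolding Let_def lam_def[symmetric] exponent by blast
qed

end
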